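(* Let $m$ be a positive integer, $V=\mathbb{F}_2^m$, and let $C=RM(1,m)\subseteq \mathbb{F}_2^V$ be the first-order Reed--Muller code (coordinates indexed by $V$), with dual code $C^\perp$. Let $T=\{0,u_1,u_2,u_3\}$ be a $4$-element subset of $V$ containing $0$. (1)(a) If $u_1+u_2\neq u_3$, then \begin{align*} J_{C,T}(w,z,x,y)=&w^4x^{2^m-4} + (2^{m-3}-1)w^4x^{2^{m-1}-4}y^{2^{m-1}} + 2^{m-1}w^3 z x^{2^{m-1}-3} y^{2^{m-1}-1} \\ &+ 3\cdot 2^{m-2}w^2z^2x^{2^{m-1}-2}y^{2^{m-1}-2}+ 2^{m-1}wz^3x^{2^{m-1}-1}y^{2^{m-1}-3}\\ &+ (2^{m-3}-1)z^4x^{2^{m-1}}y^{2^{m-1}-4}+ z^4y^{2^m-4}. \end{align*} (1)(b) If $u_1+u_2= u_3$, then \begin{align*} J_{C,T}(w,z,x,y)=&w^4x^{2^{m}-4} + (2^{m-2}-1)w^4x^{2^{m-1}-4}y^{2^{m-1}} + 3\cdot 2^{m-1}w^2z^2x^{2^{m-1}-2}y^{2^{m-1}-2} \\ &+ (2^{m-2}-1)z^4x^{2^{m-1}}y^{2^{m-1}-4} + z^4y^{2^{m}-4}. \end{align*} (2)(a) If $u_1+u_2\neq u_3$, then \begin{align*} J_{C^\perp,T}(w,z,x,y)=&\frac{1}{2^{m+1}}\Big((w+z)^4(x+y)^{2^m-4}+ (2^{m-3}-1)(w+z)^4(x+y)^{2^{m-1}-4}(x-y)^{2^{m-1}} \\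 &+ 2^{m-1}(w+z)^3 (w-z) (x+y)^{2^{m-1}-3} (x-y)^{2^{m-1}-1} \\ &+ 3\cdot 2^{m-2}(w+z)^2(w-z)^2(x+y)^{2^{m-1}-2}(x-y)^{2^{m-1}-2}\\ &+ 2^{m-1}(w+z)(w-z)^3(x+y)^{2^{m-1}-1}(x-y)^{2^{m-1}-3}\\ &+ (2^{m-3}-1)(w-z)^4(x+y)^{2^{m-1}}(x-y)^{2^{m-1}-4} + (w-z)^4(x-y)^{2^m-4}\Big). \end{align*} (2)(b) If $u_1+u_2= u_3$, then \begin{align*} J_{C^\perp,T}(w,z,x,y)=&\frac{1}{2^{m+1}}\Big((w+z)^4(x+y)^{2^{m}-4} + (2^{m-2}-1)(w+z)^4(x+y)^{2^{m-1}-4}(x-y)^{2^{m-1}} \\ &+ 3\cdot 2^{m-1}(w+z)^2(w-z)^2(x+y)^{2^{m-1}-2}(x-y)^{2^{m-1}-2} \\ &+ (2^{m-2}-1)(w-z)^4(x+y)^{2^{m-1}}(x-y)^{2^{m-1}-4} + (w-z)^4(x-y)^{2^{m}-4}\Big). \end{align*}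
   Context: $RM(1,m)=\{(\lambda(x)+b)_{x\in V}\mid \lambda\in \mathrm{Hom}(V,\mathbb{F}_2),\ b\in\mathbb{F}_2\}\subseteq \mathbb{F}_2^V$, a binary linear code of length $2^m$ whose coordinates are indexed by the points of $V$. The dual $C^\perp$ is taken with respect to the standard inner product $(x,y)=\sum_{v\in V}x_vy_v$. For a binary code $C$ with coordinate set $\Omega$ and $T\subseteq\Omega$, the Jacobi polynomial is $J_{C,T}(w,z,x,y)=\sum_{c\in C}w^{m_0(c)}z^{m_1(c)}x^{n_0(c)}y^{n_1(c)}$, where $m_i(c)=|\{j\in T\mid c_j=i\}|$ and $n_i(c)=|\{j\in \Omega\setminus T\mid c_j=i\}|$. *)

theory Defs
  imports "HOL-Analysis.Analysis" "HOL-Library.Z2" "HOL-Library.Poly_Mapping"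
begin

text \<open>
  The field with two elements is the type \<^typ>\<open>bit\<close>. The finiteness instance makes
  \<^typ>\<open>bit ^ 'n\<close> an admissible index type, so that \<^typ>\<open>bit ^ (bit ^ 'n)\<close> renders
  the space of words whose coordinates are indexed by the points of \<^typ>\<open>bit ^ 'n\<close>.
\<close>

instance bit :: finite
proof
  have "(UNIV :: bit set) = {0, 1}"
    by (auto intro: bit.exhaust)
  then show "finite (UNIV :: bit set)"
    by (metis finite.emptyI finite.insertI)
qed

definition RM1 :: "(bit ^ (bit ^ 'n)) set" where
  "RM1 = {(\<chi> x. l x + b) | (l :: bit ^ 'n \<Rightarrow> bit) (b :: bit). Vector_Spaces.linear (*s) (*) l}"

definition dual_code :: "(bit ^ 'v) set \<Rightarrow> (bit ^ 'v) set" where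
  "dual_code C = {x. \<forall>y\<in>C. (\<Sum>v\<in>UNIV. x $ v * y $ v) = 0}"

datatype jvar = Jw | Jz | Jx | Jy

text \<open>
  The polynomial ring in the four indeterminates w, z, x, y over the rationals: a polynomial is
  a finitely supported map from exponent vectors to coefficients, with the convolution
  product of \<^theory>\<open>HOL-Library.Poly_Mapping\<close>.
\<close>

type_synonym jpoly = "(jvar \<Rightarrow>\<^sub>0 nat) \<Rightarrow>\<^sub>0 rat"

definition indet :: "jvar \<Rightarrow> jpoly" where
  "indet i = Poly_Mapping.single (Poly_Mapping.single i 1) 1"

definition const_poly :: "rat \<Rightarrow> jpoly" where
  "const_poly a = Poly_Mapping.single 0 a"

definition jacobi_poly :: "(bit ^ 'v) set \<Rightarrow> 'v set \<Rightarrow> jpoly" where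
  "jacobi_poly C T =
    (\<Sum>c\<in>C. indet Jw ^ card {j \<in> T. c $ j = 0} * indet Jz ^ card {j \<in> T. c $ j = 1} *
           indet Jx ^ card {j \<in> UNIV - T. c $ j = 0} * indet Jy ^ card {j \<in> UNIV - T. c $ j = 1})"

end

theory Submission
  imports Defs
begin

text \<open>
  The words of RM(1,m) are \<open>v \<mapsto> a \<cdot> v + b\<close>. If \<open>a \<noteq> 0\<close>, such a word takes each value
  \<open>2 ^ (m - 1)\<close> times, so its contribution to the Jacobi polynomial depends only on its restriction
  to T, that is on b and the values \<open>a \<cdot> u\<^sub>i\<close>. Orthogonality of characters shows that the
  latter are equidistributed over all triples if the \<open>u\<^sub>i\<close> are independent, and over the triples
  with \<open>t\<^sub>1 + t\<^sub>2 = t\<^sub>3\<close> otherwise. All of this holds for arbitrary elements w, z, x, y of a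
  commutative ring, so the dual code follows from the MacWilliams identity, in which w, z, x, y are
  replaced by w + z, w - z, x + y, x - y.
\<close>

text \<open>These simp rules would turn sums and products of bits into bitwise operations, to which
  the ring laws used throughout do not apply.\<close>

declare add_bit_eq_xor [simp del] mult_bit_eq_and [simp del]

section \<open>Signs, the standard bilinear form and character sums over the two-element
  field\<close>

lemma UNIV_bit: "(UNIV :: bit set) = {0, 1}"
  by (auto intro: bit.exhaust)

lemma CARD_bit: "CARD(bit) = 2"
  by (simp add: UNIV_bit)

lemma bit_add_self: "b + b = (0 :: bit)"
  by (cases b) (simp_all add: add_bit_eq_xor)

lemma bit_add_eq_0_iff: "a + b = 0 \<longleftrightarrow> a = (b :: bit)"
  by (cases a; cases b) (simp_all add: bit_add_self)

lemma bit_vec_add_self: "v + v = (0 :: bit ^ 'k)"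
  by (simp add: vec_eq_iff bit_add_self)

lemma bit_vec_add_eq_0_iff: "v + w = 0 \<longleftrightarrow> v = (w :: bit ^ 'k)"
  by (simp add: vec_eq_iff bit_add_eq_0_iff)

text \<open>The nontrivial additive character of the two-element field. Integer values allow
  character sums to be compared with cardinalities.\<close>

definition bsign :: "bit \<Rightarrow> int" where
  "bsign b = (if b = 0 then 1 else - 1)"

lemma bsign_0 [simp]: "bsign 0 = 1" and bsign_1 [simp]: "bsign 1 = - 1"
  by (simp_all add: bsign_def)

lemma bsign_add: "bsign (a + b) = bsign a * bsign b"
  by (cases a; cases b) (simp_all add: bit_add_self)

lemma bsign_sum: "bsign (sum f A) = (\<Prod>i\<in>A. bsign (f i))"
  by (induction A rule: infinite_finite_induct) (simp_all add: bsign_add)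

text \<open>Used on two levels: on V, where it represents the linear functionals, and on words
  indexed by V, where it defines the dual code.\<close>

definition bdot :: "bit ^ 'k \<Rightarrow> bit ^ 'k \<Rightarrow> bit" where
  "bdot a v = (\<Sum>i\<in>UNIV. a $ i * v $ i)"

lemma bdot_commute: "bdot a v = bdot v a"
  by (simp add: bdot_def mult.commute)

lemma bdot_add_left: "bdot (a + b) v = bdot a v + bdot b v"
  by (simp add: bdot_def algebra_simps sum.distrib)

lemma bdot_add_right: "bdot a (v + w) = bdot a v + bdot a w"
  by (simp add: bdot_def algebra_simps sum.distrib)

lemma bdot_0_left [simp]: "bdot 0 v = 0" and bdot_0_right [simp]: "bdot a 0 = 0"
  by (simp_all add: bdot_def)

lemma bdot_sum_right: "bdot a (sum f A) = (\<Sum>i\<in>A. bdot a (f i))"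
  by (induction A rule: infinite_finite_induct) (simp_all add: bdot_add_right)

lemma bdot_axis_right: "bdot a (axis i 1) = a $ i"
proof -
  have "bdot a (axis i 1) = (\<Sum>j\<in>UNIV. if j = i then a $ j else 0)"
    unfolding bdot_def by (rule sum.cong) (auto simp: axis_def)
  then show ?thesis by simp
qed

lemma dual_code_iff: "d \<in> dual_code C \<longleftrightarrow> (\<forall>c\<in>C. bdot c d = 0)"
  by (simp add: dual_code_def bdot_def mult.commute)

text \<open>Translating by a word c with (c, d) = 1 negates the character sum.\<close>

lemma sum_bsign_bdot:
  fixes C :: "(bit ^ 'k) set"
  assumes closed: "\<And>c c'. c \<in> C \<Longrightarrow> c' \<in> C \<Longrightarrow> c + c' \<in> C"
  shows "(\<Sum>c\<in>C. bsign (bdot c d)) = (if d \<in> dual_code C then int (card C) else 0)"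
proof (cases "d \<in> dual_code C")
  case True
  then show ?thesis by (simp add: dual_code_iff)
next
  case False
  then obtain e where e: "e \<in> C" "bdot e d = 1"
    by (auto simp: dual_code_iff)
  have cancel: "e + (e + c) = c" for c
    by (simp add: bit_vec_add_self flip: add.assoc)
  have "(\<Sum>c\<in>C. bsign (bdot c d)) = (\<Sum>c\<in>C. bsign (bdot (e + c) d))"
    by (rule sum.reindex_bij_witness[where i = "\<lambda>c. e + c" and j = "\<lambda>c. e + c"])
      (auto simp: cancel closed e)
  also have "\<dots> = - (\<Sum>c\<in>C. bsign (bdot c d))"
    by (simp add: bdot_add_left bsign_add e sum_negf)
  finally show ?thesis using False by simp
qed

lemma dual_code_UNIV: "dual_code (UNIV :: (bit ^ 'k) set) = {0}"
proof -
  have "d = 0" if "\<forall>c. bdot c d = 0" for d :: "bit ^ 'k"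
    using that by (metis bdot_axis_right bdot_commute vec_eq_iff zero_index)
  then show ?thesis by (auto simp: dual_code_iff)
qed

lemma CARD_bit_vec: "CARD(bit ^ 'k) = 2 ^ CARD('k)"
  by (simp add: CARD_vec CARD_bit)

lemma sum_bsign_bdot_UNIV:
  "(\<Sum>a\<in>UNIV. bsign (bdot a (v :: bit ^ 'k))) = (if v = 0 then 2 ^ CARD('k) else 0)"
  by (simp add: sum_bsign_bdot dual_code_UNIV CARD_bit)

section \<open>Counting solutions of linear systems and equidistribution of values\<close>

text \<open>
  Expand the indicator of the solution set as the product over \<open>u \<in> I\<close> of half of
  \<open>1 + (- 1) ^ (a \<cdot> u + t u)\<close>; of the resulting character sums only that of the empty subset of
  \<open>I\<close> survives.
\<close>

lemma power_card_mult_card_bdot_eq: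
  fixes I :: "(bit ^ 'k) set"
  assumes indep: "\<And>S. S \<subseteq> I \<Longrightarrow> S \<noteq> {} \<Longrightarrow> \<Sum>S \<noteq> 0"
  shows "2 ^ card I * card {a. \<forall>u\<in>I. bdot a u = t u} = 2 ^ CARD('k)"
proof -
  have ind: "(\<Prod>u\<in>I. bsign (bdot a u + t u) + 1) =
      (if \<forall>u\<in>I. bdot a u = t u then 2 ^ card I else 0)" for a
  proof (cases "\<forall>u\<in>I. bdot a u = t u")
    case True
    then have "(\<Prod>u\<in>I. bsign (bdot a u + t u) + 1) = (\<Prod>u\<in>I. 2)"
      by (intro prod.cong) (simp_all add: bit_add_self)
    with True show ?thesis by simp
  next
    case False
    then obtain u where u: "u \<in> I" "bdot a u \<noteq> t u" by blast
    then have "bdot a u + t u = 1"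
      by (metis bit_add_eq_0_iff bit_not_zero_iff)
    with u have "\<exists>u\<in>I. bsign (bdot a u + t u) + 1 = 0" by force
    with False show ?thesis by (simp add: prod_zero)
  qed
  have expand: "(\<Prod>u\<in>I. bsign (bdot a u + t u) + 1) =
      (\<Sum>S\<in>Pow I. bsign (\<Sum>u\<in>S. t u) * bsign (bdot a (\<Sum>S)))" for a
    by (simp add: prod_add bdot_sum_right bsign_sum bsign_add prod.distrib mult.commute)
  have "int (2 ^ card I * card {a. \<forall>u\<in>I. bdot a u = t u}) =
      (\<Sum>a\<in>UNIV. \<Prod>u\<in>I. bsign (bdot a u + t u) + 1)"
    by (simp add: ind sum.If_cases)
  also have "\<dots> = (\<Sum>S\<in>Pow I. bsign (\<Sum>u\<in>S. t u) * (\<Sum>a\<in>UNIV. bsign (bdot a (\<Sum>S))))"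
    unfolding expand by (subst sum.swap) (simp add: sum_distrib_left)
  also have "\<dots> = (\<Sum>S\<in>Pow I. if S = {} then 2 ^ CARD('k) else 0)"
    using indep by (intro sum.cong) (auto simp: sum_bsign_bdot_UNIV)
  also have "\<dots> = int (2 ^ CARD('k))"
    by simp
  finally show ?thesis by (simp only: of_nat_eq_iff)
qed

text \<open>Over the two-element field the nontrivial linear combinations of \<open>I\<close> are
  its nonempty subset sums, so \<open>indep\<close> is linear independence. The product identity
  yields the bound, by divisibility of powers of 2, and then the count, by cancellation.\<close>

lemma card_bdot_eq_independent:
  fixes I :: "(bit ^ 'k) set"
  assumes indep: "\<And>S. S \<subseteq> I \<Longrightarrow> S \<noteq> {} \<Longrightarrow> \<Sum>S \<noteq> 0"
  shows "card I \<le> CARD('k)"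
    and "card {a. \<forall>u\<in>I. bdot a u = t u} = 2 ^ (CARD('k) - card I)"
proof -
  have eq: "2 ^ card I * card {a. \<forall>u\<in>I. bdot a u = t u} = 2 ^ CARD('k)"
    by (rule power_card_mult_card_bdot_eq[OF indep])
  have "(2::nat) ^ card I dvd 2 ^ CARD('k)"
    by (subst eq[symmetric]) (rule dvd_triv_left)
  then show le: "card I \<le> CARD('k)"
    by (rule power_dvd_imp_le) simp
  have "(2::nat) ^ CARD('k) = 2 ^ card I * 2 ^ (CARD('k) - card I)"
    using le by (simp only: power_add[symmetric] le_add_diff_inverse)
  with eq show "card {a. \<forall>u\<in>I. bdot a u = t u} = 2 ^ (CARD('k) - card I)"
    by simp
qed

text \<open>By symmetry of the form, \<open>v\<close> may be read as the unknown functional and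
  \<open>a\<close> as the point; the singleton \<open>{a}\<close> is independent because
  \<open>a\<close> is nonzero.\<close>

lemma card_bdot_affine:
  fixes a :: "bit ^ 'k"
  assumes "a \<noteq> 0"
  shows "card {v. bdot a v + b = e} = 2 ^ (CARD('k) - 1)"
proof -
  have "bdot a v + b = e \<longleftrightarrow> bdot v a = e + b" for v
    by (cases "bdot a v"; cases b; cases e) (simp_all add: bdot_commute[of v a] bit_add_self)
  moreover have "card {v. \<forall>u\<in>{a}. bdot v u = e + b} = 2 ^ (CARD('k) - card {a})"
    by (rule card_bdot_eq_independent) (use assms in \<open>auto simp: subset_singleton_iff\<close>)
  ultimately show ?thesis by simp
qed

lemma sum_fibres:
  fixes f :: "'b::finite \<Rightarrow> 'c::comm_semiring_1" and g :: "'a::finite \<Rightarrow> 'b"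
  assumes "\<And>t. t \<in> R \<Longrightarrow> card {a. g a = t} = N" and "\<And>a. g a \<in> R"
  shows "(\<Sum>a\<in>UNIV. f (g a)) = of_nat N * (\<Sum>t\<in>R. f t)"
proof -
  have "(\<Sum>a\<in>UNIV. f (g a)) = (\<Sum>t\<in>R. \<Sum>a | a \<in> UNIV \<and> g a = t. f (g a))"
    by (rule sum.group[symmetric]) (use assms in auto)
  also have "\<dots> = (\<Sum>t\<in>R. of_nat N * f t)"
    by (rule sum.cong) (simp_all add: assms)
  finally show ?thesis by (simp add: sum_distrib_left)
qed

text \<open>Four distinct points exclude zero vectors and coincidences, and
  \<open>u1 + u2 \<noteq> u3\<close> excludes the one remaining dependency. So the three vectors are
  independent and every triple of values has a fibre of the same size.\<close>

lemma sum_bdot_triple: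
  fixes u1 u2 u3 :: "bit ^ 'k" and f :: "bit \<Rightarrow> bit \<Rightarrow> bit \<Rightarrow> 'c::comm_semiring_1"
  assumes "card {0, u1, u2, u3} = 4" and "u1 + u2 \<noteq> u3"
  shows "3 \<le> CARD('k)"
    and "(\<Sum>a\<in>UNIV. f (bdot a u1) (bdot a u2) (bdot a u3)) =
      2 ^ (CARD('k) - 3) * (\<Sum>t1\<in>UNIV. \<Sum>t2\<in>UNIV. \<Sum>t3\<in>UNIV. f t1 t2 t3)"
proof -
  have distinct: "u1 \<noteq> 0" "u2 \<noteq> 0" "u3 \<noteq> 0" "u1 \<noteq> u2" "u1 \<noteq> u3" "u2 \<noteq> u3"
    using assms(1) by (auto simp: card_insert_if split: if_splits)
  let ?I = "{u1, u2, u3}"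
  have card: "card ?I = 3" using distinct by simp
  have indep: "\<Sum>S \<noteq> 0" if "S \<subseteq> ?I" "S \<noteq> {}" for S
  proof -
    have "S \<in> Pow ?I" using that by simp
    then have "S = {u1} \<or> S = {u2} \<or> S = {u3} \<or> S = {u1, u2} \<or> S = {u1, u3} \<or> S = {u2, u3} \<or> S = ?I"
      using that(2) by (simp only: Pow_insert Pow_empty image_insert image_empty image_Un
          Un_iff insert_iff empty_iff) argo
    then show ?thesis
      using distinct assms(2) by (auto simp: bit_vec_add_eq_0_iff simp flip: add.assoc)
  qed
  show "3 \<le> CARD('k)" using card_bdot_eq_independent(1)[of ?I, OF indep] card by simp
  have fibre: "card {a. (bdot a u1, bdot a u2, bdot a u3) = t} = 2 ^ (CARD('k) - 3)" for t
  proof -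
    obtain t1 t2 t3 where t: "t = (t1, t2, t3)" by (cases t)
    show ?thesis
      \<comment> \<open>The prescribed values form one function on vectors: \<open>u1\<close> and
        \<open>u2\<close> are overridden, and the default \<open>t3\<close> serves
        \<open>u3\<close>.\<close>
      using card_bdot_eq_independent(2)[of ?I "(\<lambda>_. t3)(u1 := t1, u2 := t2)", OF indep] card distinct
      by (simp add: t)
  qed
  have "(\<Sum>a\<in>UNIV. (\<lambda>(t1, t2, t3). f t1 t2 t3) (bdot a u1, bdot a u2, bdot a u3)) =
      of_nat (2 ^ (CARD('k) - 3)) * (\<Sum>(t1, t2, t3)\<in>UNIV. f t1 t2 t3)"
    by (rule sum_fibres) (auto simp: fibre)
  then show "(\<Sum>a\<in>UNIV. f (bdot a u1) (bdot a u2) (bdot a u3)) =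
      2 ^ (CARD('k) - 3) * (\<Sum>t1\<in>UNIV. \<Sum>t2\<in>UNIV. \<Sum>t3\<in>UNIV. f t1 t2 t3)"
    by (simp add: sum.cartesian_product)
qed

text \<open>Serves the case \<open>u1 + u2 = u3\<close>, where the value at \<open>u3\<close> is
  determined by the other two and only \<open>u1\<close>, \<open>u2\<close> are independent.\<close>

lemma sum_bdot_pair:
  fixes u1 u2 :: "bit ^ 'k" and f :: "bit \<Rightarrow> bit \<Rightarrow> 'c::comm_semiring_1"
  assumes distinct: "u1 \<noteq> 0" "u2 \<noteq> 0" "u1 \<noteq> u2"
  shows "2 \<le> CARD('k)"
    and "(\<Sum>a\<in>UNIV. f (bdot a u1) (bdot a u2)) =
      2 ^ (CARD('k) - 2) * (\<Sum>t1\<in>UNIV. \<Sum>t2\<in>UNIV. f t1 t2)"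
proof -
  let ?I = "{u1, u2}"
  have card: "card ?I = 2" using distinct by simp
  have indep: "\<Sum>S \<noteq> 0" if "S \<subseteq> ?I" "S \<noteq> {}" for S
  proof -
    have "S \<in> Pow ?I" using that by simp
    then have "S \<in> {{u1}, {u2}, {u1,u2}}"
      using that(2) by (auto simp: Pow_insert)
    then show ?thesis
      using distinct by (auto simp: bit_vec_add_eq_0_iff)
  qed
  show "2 \<le> CARD('k)" using card_bdot_eq_independent(1)[of ?I, OF indep] card by simp
  have fibre: "card {a. (bdot a u1, bdot a u2) = t} = 2 ^ (CARD('k) - 2)" for t
  proof -
    obtain t1 t2 where t: "t = (t1, t2)" by (cases t)
    show ?thesis
      using card_bdot_eq_independent(2)[of ?I "(\<lambda>_. t2)(u1 := t1)", OF indep] card distinct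
      by (simp add: t)
  qed
  have "(\<Sum>a\<in>UNIV. (\<lambda>(t1, t2). f t1 t2) (bdot a u1, bdot a u2)) =
      of_nat (2 ^ (CARD('k) - 2)) * (\<Sum>(t1, t2)\<in>UNIV. f t1 t2)"
    by (rule sum_fibres) (auto simp: fibre)
  then show "(\<Sum>a\<in>UNIV. f (bdot a u1) (bdot a u2)) =
      2 ^ (CARD('k) - 2) * (\<Sum>t1\<in>UNIV. \<Sum>t2\<in>UNIV. f t1 t2)"
    by (simp add: sum.cartesian_product)
qed

section \<open>Parametrisation of the first-order Reed-Muller code\<close>

definition rm_word :: "bit ^ 'n \<Rightarrow> bit \<Rightarrow> bit ^ (bit ^ 'n)" where
  "rm_word a b = (\<chi> v. bdot a v + b)"

lemma rm_word_nth [simp]: "rm_word a b $ v = bdot a v + b"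
  by (simp add: rm_word_def)

lemma linear_functional_iff_bdot:
  fixes l :: "bit ^ 'n \<Rightarrow> bit"
  shows "Vector_Spaces.linear (*s) (*) l \<longleftrightarrow> (\<exists>a. l = bdot a)"
proof
  assume lin: "Vector_Spaces.linear (*s) (*) l"
  then interpret l: Vector_Spaces.linear "(*s)" "(*)" l .
  \<comment> \<open>The representing vector lists the values of \<open>l\<close> on the standard
    basis.\<close>
  have "l v = bdot (\<chi> i. l (axis i 1)) v" for v
  proof -
    have "l v = l (\<Sum>i\<in>UNIV. v $ i *s axis i 1)"
      by (simp add: basis_expansion)
    also have "\<dots> = (\<Sum>i\<in>UNIV. v $ i * l (axis i 1))"
      by (simp add: l.sum l.scale)
    finally show ?thesis by (simp add: bdot_def mult.commute)
  qed
  then show "\<exists>a. l = bdot a" by blast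
next
  assume "\<exists>a. l = bdot a"
  then obtain a where a: "l = bdot a" ..
  have "vector_space ((*) :: bit \<Rightarrow> bit \<Rightarrow> bit)"
    by unfold_locales (simp_all add: algebra_simps)
  moreover have "vector_space ((*s) :: bit \<Rightarrow> bit ^ 'n \<Rightarrow> bit ^ 'n)"
    by (rule vec.vector_space_axioms)
  ultimately show "Vector_Spaces.linear (*s) (*) l"
    unfolding Vector_Spaces.linear_iff a
    by (simp add: bdot_add_right) (simp add: bdot_def sum_distrib_left algebra_simps)
qed

lemma RM1_eq: "RM1 = (\<lambda>(a, b). rm_word a b) ` UNIV"
  unfolding RM1_def linear_functional_iff_bdot rm_word_def by (auto simp: image_def)

lemma inj_rm_word: "inj (\<lambda>(a, b). rm_word (a :: bit ^ 'n) b)"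
proof -
  have "a = a' \<and> b = b'" if "rm_word a b = rm_word a' b'" for a a' :: "bit ^ 'n" and b b'
  proof -
    have eq: "bdot a v + b = bdot a' v + b'" for v
      using that by (metis rm_word_nth)
    \<comment> \<open>Evaluation at 0 recovers \<open>b\<close>; evaluation at the unit vectors then
      recovers \<open>a\<close>.\<close>
    from eq[of 0] have "b = b'" by simp
    with eq have "bdot a v = bdot a' v" for v by simp
    then have "a $ i = a' $ i" for i by (metis bdot_axis_right)
    with \<open>b = b'\<close> show ?thesis by (simp add: vec_eq_iff)
  qed
  then show ?thesis by (auto simp: inj_def)
qed

lemma card_RM1: "card (RM1 :: (bit ^ (bit ^ 'n)) set) = 2 ^ (CARD('n) + 1)"
  unfolding RM1_eq by (simp add: card_image inj_rm_word CARD_bit CARD_bit_vec)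

lemma RM1_add_closed:
  fixes c c' :: "bit ^ (bit ^ 'n)"
  assumes "c \<in> RM1" "c' \<in> RM1"
  shows "c + c' \<in> RM1"
proof -
  have "rm_word a b + rm_word a' b' = rm_word (a + a') (b + b')" for a a' :: "bit ^ 'n" and b b'
    by (simp add: vec_eq_iff bdot_add_left)
  with assms show ?thesis by (force simp: RM1_eq image_iff)
qed

section \<open>Jacobi polynomials at ring elements and the MacWilliams identity\<close>

text \<open>Generalises \<open>jacobi_poly\<close> from the indeterminates to arbitrary ring
  elements, so that the substitution in the MacWilliams identity is plain instantiation.\<close>

definition jacobi_at ::
    "(bit ^ 'v) set \<Rightarrow> 'v set \<Rightarrow> 'a \<Rightarrow> 'a \<Rightarrow> 'a \<Rightarrow> 'a \<Rightarrow> 'a::comm_ring_1" where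
  "jacobi_at C T w z x y =
    (\<Sum>c\<in>C. w ^ card {j \<in> T. c $ j = 0} * z ^ card {j \<in> T. c $ j = 1} *
           x ^ card {j \<in> UNIV - T. c $ j = 0} * y ^ card {j \<in> UNIV - T. c $ j = 1})"

lemma jacobi_poly_eq: "jacobi_poly C T = jacobi_at C T (indet Jw) (indet Jz) (indet Jx) (indet Jy)"
  by (simp add: jacobi_poly_def jacobi_at_def)

lemma prod_bit_cases:
  fixes c :: "'v::finite \<Rightarrow> bit" and p q :: "'a::comm_ring_1"
  shows "(\<Prod>v\<in>A. if c v = 0 then p else q) = p ^ card {v \<in> A. c v = 0} * q ^ card {v \<in> A. c v = 1}"
proof -
  have "A \<inter> {v. c v = 0} = {v \<in> A. c v = 0}" "A \<inter> - {v. c v = 0} = {v \<in> A. c v = 1}"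
    by auto
  then show ?thesis by (simp add: prod.If_cases)
qed

text \<open>Each coordinate contributes one factor, chosen by its bit and by membership in
  \<open>T\<close>; in this form a codeword sum can be transformed coordinate by coordinate.\<close>

lemma jacobi_at_prod:
  fixes C :: "(bit ^ 'v) set" and w z x y :: "'a::comm_ring_1"
  shows "jacobi_at C T w z x y = (\<Sum>c\<in>C. \<Prod>v\<in>UNIV.
    if c $ v = 0 then (if v \<in> T then w else x) else (if v \<in> T then z else y))"
proof -
  have "(\<Prod>v\<in>UNIV. if c $ v = 0 then (if v \<in> T then w else x) else (if v \<in> T then z else y)) =
      (\<Prod>v\<in>T. if c $ v = 0 then w else z) * (\<Prod>v\<in>UNIV - T. if c $ v = 0 then x else y)" for c :: "bit ^ 'v"
    by (subst mult.commute, subst prod.subset_diff[of T UNIV])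
      (auto intro!: arg_cong2[where f = "(*)"] prod.cong)
  then show ?thesis
    by (simp add: jacobi_at_def prod_bit_cases mult.assoc)
qed

text \<open>A discrete Fourier expansion: each factor is a sum over a bit \<open>e\<close>, with
  \<open>q v\<close> carrying the sign of \<open>c $ v\<close>. Distributing the product chooses one
  bit per coordinate, that is, a word \<open>d\<close>.\<close>

lemma prod_add_bsign_expand:
  fixes p q :: "'v::finite \<Rightarrow> 'a::comm_ring_1" and c :: "bit ^ 'v"
  shows "(\<Prod>v\<in>UNIV. if c $ v = 0 then p v + q v else p v - q v) =
    (\<Sum>d\<in>UNIV. of_int (bsign (bdot c d)) * (\<Prod>v\<in>UNIV. if d $ v = 0 then p v else q v))"
proof -
  have "(\<Prod>v\<in>UNIV. if c $ v = 0 then p v + q v else p v - q v) =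
      (\<Prod>v\<in>UNIV. \<Sum>e\<in>UNIV. of_int (bsign (c $ v * e)) * (if e = 0 then p v else q v))"
    by (rule prod.cong) (auto simp: UNIV_bit)
  also have "\<dots> = (\<Sum>g\<in>PiE UNIV (\<lambda>_. UNIV).
      \<Prod>v\<in>UNIV. of_int (bsign (c $ v * g v)) * (if g v = 0 then p v else q v))"
    by (rule prod_sum_PiE) auto
  also have "\<dots> = (\<Sum>d\<in>UNIV. \<Prod>v\<in>UNIV. of_int (bsign (c $ v * d $ v)) * (if d $ v = 0 then p v else q v))"
    by (rule sum.reindex_bij_witness[where i = vec_nth and j = vec_lambda])
      (auto simp: PiE_def)
  finally show ?thesis
    by (simp add: prod.distrib bdot_def bsign_sum)
qed

text \<open>Expand every codeword product into signed words \<open>d\<close> and swap the sums: the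
  character sum over \<open>C\<close> is \<open>card C\<close> for \<open>d\<close> in the dual code
  and 0 otherwise.\<close>

theorem jacobi_macwilliams:
  fixes C :: "(bit ^ 'v) set" and w z x y :: "'a::comm_ring_1"
  assumes "\<And>c c'. c \<in> C \<Longrightarrow> c' \<in> C \<Longrightarrow> c + c' \<in> C"
  shows "of_nat (card C) * jacobi_at (dual_code C) T w z x y =
    jacobi_at C T (w + z) (w - z) (x + y) (x - y)"
proof -
  let ?p = "\<lambda>v. if v \<in> T then w else x" and ?q = "\<lambda>v. if v \<in> T then z else y"
  let ?P = "\<lambda>d. \<Prod>v\<in>UNIV. if d $ v = 0 then ?p v else ?q v"
  have "jacobi_at C T (w + z) (w - z) (x + y) (x - y) =
      (\<Sum>c\<in>C. \<Prod>v\<in>UNIV. if c $ v = 0 then ?p v + ?q v else ?p v - ?q v)"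
    unfolding jacobi_at_prod by (intro sum.cong prod.cong) auto
  also have "\<dots> = (\<Sum>d\<in>UNIV. \<Sum>c\<in>C. of_int (bsign (bdot c d)) * ?P d)"
    unfolding prod_add_bsign_expand by (rule sum.swap)
  also have "\<dots> = (\<Sum>d\<in>UNIV. of_int (\<Sum>c\<in>C. bsign (bdot c d)) * ?P d)"
    by (simp only: of_int_sum sum_distrib_right)
  also have "\<dots> = (\<Sum>d\<in>UNIV. if d \<in> dual_code C then of_nat (card C) * ?P d else 0)"
    by (intro sum.cong) (simp_all add: sum_bsign_bdot[OF assms])
  also have "\<dots> = of_nat (card C) * (\<Sum>d\<in>dual_code C. ?P d)"
    by (simp add: sum.If_cases sum_distrib_left)
  finally show ?thesis unfolding jacobi_at_prod by simp
qed

section \<open>The Jacobi polynomial of the Reed-Muller code\<close>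

text \<open>For nonzero \<open>a\<close> each value is taken \<open>M\<close> times, so the counts
  outside \<open>T\<close> are \<open>M\<close> minus those inside, which gives \<open>F\<close>.
  The two constant words, with \<open>a = 0\<close>, are counted separately. The sum of
  \<open>F\<close> still runs over all \<open>a\<close>, to suit equidistribution, and the
  fictitious terms at 0 are subtracted; they cause the \<open>- 1\<close> in the final
  coefficients.\<close>

lemma jacobi_at_RM1:
  fixes T :: "(bit ^ 'n) set" and w z x y :: "'a::comm_ring_1"
  defines "M \<equiv> 2 ^ (CARD('n) - 1)"
  defines "F \<equiv> \<lambda>a b. w ^ card {j \<in> T. bdot a j + b = 0} * z ^ card {j \<in> T. bdot a j + b = 1} *
    x ^ (M - card {j \<in> T. bdot a j + b = 0}) * y ^ (M - card {j \<in> T. bdot a j + b = 1})"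
  shows "jacobi_at RM1 T w z x y =
    w ^ card T * x ^ (2 ^ CARD('n) - card T) + z ^ card T * y ^ (2 ^ CARD('n) - card T)
    - (w ^ card T * x ^ (M - card T) * y ^ M + z ^ card T * x ^ M * y ^ (M - card T))
    + (\<Sum>a\<in>UNIV. F a 0 + F a 1)"
proof -
  define H where "H = (\<lambda>a b. w ^ card {j \<in> T. bdot a j + b = 0} * z ^ card {j \<in> T. bdot a j + b = 1} *
    x ^ card {j \<in> UNIV - T. bdot a j + b = 0} * y ^ card {j \<in> UNIV - T. bdot a j + b = 1})"
  have HF: "H a b = F a b" if "a \<noteq> 0" for a b
  proof -
    have "card {j \<in> UNIV - T. bdot a j + b = e} = M - card {j \<in> T. bdot a j + b = e}" for e
    proof -
      have "{j \<in> UNIV - T. bdot a j + b = e} = {j. bdot a j + b = e} - {j \<in> T. bdot a j + b = e}"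
        by auto
      then have "card {j \<in> UNIV - T. bdot a j + b = e} =
          card {j. bdot a j + b = e} - card {j \<in> T. bdot a j + b = e}"
        by (simp add: card_Diff_subset subset_eq)
      then show ?thesis by (simp add: card_bdot_affine[OF that] M_def)
    qed
    then show ?thesis by (simp add: H_def F_def)
  qed
  have H0: "H 0 0 + H 0 1 =
      w ^ card T * x ^ (2 ^ CARD('n) - card T) + z ^ card T * y ^ (2 ^ CARD('n) - card T)"
    by (simp add: H_def Collect_neg_eq Compl_eq_Diff_UNIV card_Diff_subset CARD_bit)
  have F0: "F 0 0 + F 0 1 = w ^ card T * x ^ (M - card T) * y ^ M + z ^ card T * x ^ M * y ^ (M - card T)"
    by (simp add: F_def)
  have "jacobi_at RM1 T w z x y = (\<Sum>(a, b)\<in>UNIV. H a b)"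
    unfolding jacobi_at_def RM1_eq
    by (subst sum.reindex[OF inj_rm_word]) (simp add: H_def case_prod_unfold)
  also have "\<dots> = (\<Sum>a\<in>UNIV. \<Sum>b\<in>UNIV. H a b)"
    by (simp add: sum.cartesian_product)
  also have "\<dots> = (\<Sum>a\<in>UNIV. H a 0 + H a 1)"
    by (simp add: UNIV_bit)
  also have "\<dots> = H 0 0 + H 0 1 + (\<Sum>a\<in>UNIV - {0}. F a 0 + F a 1)"
    by (subst sum.remove[of UNIV 0]) (simp_all add: HF)
  also have "(\<Sum>a\<in>UNIV - {0}. F a 0 + F a 1) = (\<Sum>a\<in>UNIV. F a 0 + F a 1) - (F 0 0 + F 0 1)"
    by (subst sum.remove[of UNIV 0]) simp_all
  finally show ?thesis unfolding H0 F0 by simp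
qed

lemma card_filter_four:
  assumes "card {p, q, r, s} = 4"
  shows "card {j \<in> {p, q, r, s}. P j} =
    of_bool (P p) + of_bool (P q) + of_bool (P r) + of_bool (P s)"
proof -
  have "p \<noteq> q" "p \<noteq> r" "p \<noteq> s" "q \<noteq> r" "q \<noteq> s" "r \<noteq> s"
    using assms by (auto simp: card_insert_if split: if_splits)
  moreover have "{j \<in> {p, q, r, s}. P j} = (if P p then {p} else {}) \<union> (if P q then {q} else {}) \<union>
    (if P r then {r} else {}) \<union> (if P s then {s} else {})" by auto
  ultimately show ?thesis by (simp add: card_insert_if)
qed

lemma jacobi_at_RM1_independent:
  fixes u1 u2 u3 :: "bit ^ 'n" and w z x y :: "'a::comm_ring_1"
  assumes card: "card {0, u1, u2, u3} = 4" and indep: "u1 + u2 \<noteq> u3" and m: "m = CARD('n)"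
  shows "jacobi_at RM1 {0, u1, u2, u3} w z x y =
         w^4 * x^(2^m - 4)
         + (2^(m-3) - 1) * w^4 * x^(2^(m-1) - 4) * y^(2^(m-1))
         + 2^(m-1) * w^3 * z * x^(2^(m-1) - 3) * y^(2^(m-1) - 1)
         + 3 * 2^(m-2) * w^2 * z^2 * x^(2^(m-1) - 2) * y^(2^(m-1) - 2)
         + 2^(m-1) * w * z^3 * x^(2^(m-1) - 1) * y^(2^(m-1) - 3)
         + (2^(m-3) - 1) * z^4 * x^(2^(m-1)) * y^(2^(m-1) - 4)
         + z^4 * y^(2^m - 4)"
proof -
  define M :: nat where "M = 2 ^ (m - 1)"
  \<comment> \<open>The contribution of a nonconstant word with \<open>k\<close> zeros and
    \<open>l\<close> ones on \<open>T\<close>.\<close>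
  define G where "G k l = w ^ k * z ^ l * x ^ (M - k) * y ^ (M - l)" for k l
  \<comment> \<open>The number of points of \<open>T\<close> at which the word with constant term
    \<open>b\<close> and functional values 0, \<open>t1\<close>, \<open>t2\<close>,
    \<open>t3\<close> equals \<open>e\<close>; the first summand belongs to the point 0.\<close>
  define cnt :: "bit \<Rightarrow> bit \<Rightarrow> bit \<Rightarrow> bit \<Rightarrow> bit \<Rightarrow> nat" where
    "cnt b e t1 t2 t3 = of_bool (b = e) + of_bool (t1 + b = e) + of_bool (t2 + b = e) + of_bool (t3 + b = e)"
    for b e t1 t2 t3
  define f where "f t1 t2 t3 = G (cnt 0 0 t1 t2 t3) (cnt 0 1 t1 t2 t3) +
    G (cnt 1 0 t1 t2 t3) (cnt 1 1 t1 t2 t3)" for t1 t2 t3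
  have "jacobi_at RM1 {0, u1, u2, u3} w z x y =
      w ^ 4 * x ^ (2 ^ m - 4) + z ^ 4 * y ^ (2 ^ m - 4)
      - (w ^ 4 * x ^ (M - 4) * y ^ M + z ^ 4 * x ^ M * y ^ (M - 4))
      + (\<Sum>a\<in>UNIV. f (bdot a u1) (bdot a u2) (bdot a u3))"
    unfolding jacobi_at_RM1 card card_filter_four[OF card] f_def G_def cnt_def M_def m by simp
  also have "(\<Sum>a\<in>UNIV. f (bdot a u1) (bdot a u2) (bdot a u3)) =
      2 ^ (m - 3) * (\<Sum>t1\<in>UNIV. \<Sum>t2\<in>UNIV. \<Sum>t3\<in>UNIV. f t1 t2 t3)"
    unfolding m by (rule sum_bdot_triple(2)[OF card indep])
  \<comment> \<open>With both choices of \<open>b\<close>, the restrictions to \<open>T\<close> run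
    once through all 16 binary words of length 4, hence the binomial coefficients.\<close>
  also have "(\<Sum>t1\<in>UNIV. \<Sum>t2\<in>UNIV. \<Sum>t3\<in>UNIV. f t1 t2 t3) =
      G 4 0 + 4 * G 3 1 + 6 * G 2 2 + 4 * G 1 3 + G 0 4"
    by (simp add: UNIV_bit f_def cnt_def bit_add_self eval_nat_numeral)
  finally have eq: "jacobi_at RM1 {0, u1, u2, u3} w z x y =
      w ^ 4 * x ^ (2 ^ m - 4) + z ^ 4 * y ^ (2 ^ m - 4)
      - (w ^ 4 * x ^ (M - 4) * y ^ M + z ^ 4 * x ^ M * y ^ (M - 4))
      + 2 ^ (m - 3) * (G 4 0 + 4 * G 3 1 + 6 * G 2 2 + 4 * G 1 3 + G 0 4)" .
  \<comment> \<open>The bound makes the subtractions in the exponents exact, so that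
    \<open>4 * 2^(m-3) = 2^(m-1)\<close> and \<open>6 * 2^(m-3) = 3 * 2^(m-2)\<close>.\<close>
  have "3 \<le> m" unfolding m by (rule sum_bdot_triple(1)[OF card indep])
  then obtain k where "m = k + 3" by (metis le_add_diff_inverse2)
  then have pw: "(2::'a) ^ (m - 1) = 4 * 2 ^ (m - 3)" "(2::'a) ^ (m - 2) = 2 * 2 ^ (m - 3)"
    by (simp_all add: power_add eval_nat_numeral)
  show ?thesis
    unfolding eq pw M_def[symmetric] G_def by (simp add: algebra_simps)
qed

text \<open>The four values on \<open>T\<close> now sum to 0. For \<open>m = 2\<close> the exponent
  \<open>2^(m-1) - 4\<close> truncates to 0, harmlessly, since its coefficient
  \<open>2^(m-2) - 1\<close> vanishes.\<close>

lemma jacobi_at_RM1_dependent: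
  fixes u1 u2 u3 :: "bit ^ 'n" and w z x y :: "'a::comm_ring_1"
  assumes card: "card {0, u1, u2, u3} = 4" and dep: "u1 + u2 = u3" and m: "m = CARD('n)"
  shows "jacobi_at RM1 {0, u1, u2, u3} w z x y =
         w^4 * x^(2^m - 4)
         + (2^(m-2) - 1) * w^4 * x^(2^(m-1) - 4) * y^(2^(m-1))
         + 3 * 2^(m-1) * w^2 * z^2 * x^(2^(m-1) - 2) * y^(2^(m-1) - 2)
         + (2^(m-2) - 1) * z^4 * x^(2^(m-1)) * y^(2^(m-1) - 4)
         + z^4 * y^(2^m - 4)"
proof -
  define M :: nat where "M = 2 ^ (m - 1)"
  define G where "G k l = w ^ k * z ^ l * x ^ (M - k) * y ^ (M - l)" for k l
  define cnt :: "bit \<Rightarrow> bit \<Rightarrow> bit \<Rightarrow> bit \<Rightarrow> nat" where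
    "cnt b e t1 t2 = of_bool (b = e) + of_bool (t1 + b = e) + of_bool (t2 + b = e) + of_bool (t1 + t2 + b = e)"
    for b e t1 t2
  define f where "f t1 t2 = G (cnt 0 0 t1 t2) (cnt 0 1 t1 t2) +
    G (cnt 1 0 t1 t2) (cnt 1 1 t1 t2)" for t1 t2
  have distinct: "u1 \<noteq> 0" "u2 \<noteq> 0" "u1 \<noteq> u2"
    using card by (auto simp: card_insert_if split: if_splits)
  have "jacobi_at RM1 {0, u1, u2, u3} w z x y =
      w ^ 4 * x ^ (2 ^ m - 4) + z ^ 4 * y ^ (2 ^ m - 4)
      - (w ^ 4 * x ^ (M - 4) * y ^ M + z ^ 4 * x ^ M * y ^ (M - 4))
      + (\<Sum>a\<in>UNIV. f (bdot a u1) (bdot a u2))"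
    unfolding jacobi_at_RM1 card card_filter_four[OF card] f_def G_def cnt_def M_def m
    by (simp add: bdot_add_right flip: dep)
  also have "(\<Sum>a\<in>UNIV. f (bdot a u1) (bdot a u2)) =
      2 ^ (m - 2) * (\<Sum>t1\<in>UNIV. \<Sum>t2\<in>UNIV. f t1 t2)"
    unfolding m by (rule sum_bdot_pair(2)[OF distinct])
  \<comment> \<open>The restrictions to \<open>T\<close> are the 8 words of even weight and length
    4: one of weight 0, six of weight 2, one of weight 4.\<close>
  also have "(\<Sum>t1\<in>UNIV. \<Sum>t2\<in>UNIV. f t1 t2) = G 4 0 + 6 * G 2 2 + G 0 4"
    by (simp add: UNIV_bit f_def cnt_def bit_add_self eval_nat_numeral)
  finally have eq: "jacobi_at RM1 {0, u1, u2, u3} w z x y =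
      w ^ 4 * x ^ (2 ^ m - 4) + z ^ 4 * y ^ (2 ^ m - 4)
      - (w ^ 4 * x ^ (M - 4) * y ^ M + z ^ 4 * x ^ M * y ^ (M - 4))
      + 2 ^ (m - 2) * (G 4 0 + 6 * G 2 2 + G 0 4)" .
  have "2 \<le> m" unfolding m by (rule sum_bdot_pair(1)[OF distinct])
  then obtain k where "m = k + 2" by (metis le_add_diff_inverse2)
  then have pw: "(2::'a) ^ (m - 1) = 2 * 2 ^ (m - 2)"
    by (simp add: power_add eval_nat_numeral)
  show ?thesis
    unfolding eq pw M_def[symmetric] G_def by (simp add: algebra_simps)
qed

section \<open>Transfer to the dual code in the polynomial ring\<close>

text \<open>Polynomials do not form a field, so division by the size of the code is multiplication
  by a constant polynomial.\<close>

lemma const_poly_inverse_power: "const_poly (1 / 2 ^ k) * 2 ^ k = 1"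
proof -
  have "(2 :: jpoly) ^ k = const_poly (2 ^ k)"
    using single_of_nat[of "2 ^ k", where ?'b = rat, symmetric] by (simp add: const_poly_def)
  then show ?thesis by (simp add: const_poly_def mult_single)
qed

lemma jacobi_poly_dual_RM1:
  fixes T :: "(bit ^ 'n) set"
  shows "jacobi_poly (dual_code RM1) T = const_poly (1 / 2 ^ (CARD('n) + 1)) *
    jacobi_at RM1 T (indet Jw + indet Jz) (indet Jw - indet Jz) (indet Jx + indet Jy) (indet Jx - indet Jy)"
proof -
  have eq: "of_nat (card (RM1 :: (bit ^ (bit ^ 'n)) set)) * jacobi_poly (dual_code RM1) T =
      jacobi_at RM1 T (indet Jw + indet Jz) (indet Jw - indet Jz) (indet Jx + indet Jy) (indet Jx - indet Jy)"
    unfolding jacobi_poly_eq by (rule jacobi_macwilliams) (rule RM1_add_closed)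
  show ?thesis
    by (simp only: eq[symmetric] card_RM1 of_nat_power of_nat_numeral mult.assoc[symmetric]
        const_poly_inverse_power mult_1_left)
qed

theorem theorem1p1:
  fixes m :: nat
    and u1 u2 u3 :: "bit ^ 'n"
    and T :: "(bit ^ 'n) set"
    and C :: "(bit ^ (bit ^ 'n)) set"
    and w z x y :: jpoly
  assumes m: "m = CARD('n)"
    and C: "C = RM1"
    and T: "T = {0, u1, u2, u3}" "card T = 4"
    and vars: "w = indet Jw" "z = indet Jz" "x = indet Jx" "y = indet Jy"
  shows
    "(u1 + u2 \<noteq> u3 \<longrightarrow>
       jacobi_poly C T =
         w^4 * x^(2^m - 4)
         + (2^(m-3) - 1) * w^4 * x^(2^(m-1) - 4) * y^(2^(m-1))
         + 2^(m-1) * w^3 * z * x^(2^(m-1) - 3) * y^(2^(m-1) - 1)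
         + 3 * 2^(m-2) * w^2 * z^2 * x^(2^(m-1) - 2) * y^(2^(m-1) - 2)
         + 2^(m-1) * w * z^3 * x^(2^(m-1) - 1) * y^(2^(m-1) - 3)
         + (2^(m-3) - 1) * z^4 * x^(2^(m-1)) * y^(2^(m-1) - 4)
         + z^4 * y^(2^m - 4))
     \<and> (u1 + u2 = u3 \<longrightarrow>
       jacobi_poly C T =
         w^4 * x^(2^m - 4)
         + (2^(m-2) - 1) * w^4 * x^(2^(m-1) - 4) * y^(2^(m-1))
         + 3 * 2^(m-1) * w^2 * z^2 * x^(2^(m-1) - 2) * y^(2^(m-1) - 2)
         + (2^(m-2) - 1) * z^4 * x^(2^(m-1)) * y^(2^(m-1) - 4)
         + z^4 * y^(2^m - 4))
     \<and> (u1 + u2 \<noteq> u3 \<longrightarrow>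
       jacobi_poly (dual_code C) T =
         const_poly (1 / 2^(m+1)) *
         ((w + z)^4 * (x + y)^(2^m - 4)
         + (2^(m-3) - 1) * (w + z)^4 * (x + y)^(2^(m-1) - 4) * (x - y)^(2^(m-1))
         + 2^(m-1) * (w + z)^3 * (w - z) * (x + y)^(2^(m-1) - 3) * (x - y)^(2^(m-1) - 1)
         + 3 * 2^(m-2) * (w + z)^2 * (w - z)^2 * (x + y)^(2^(m-1) - 2) * (x - y)^(2^(m-1) - 2)
         + 2^(m-1) * (w + z) * (w - z)^3 * (x + y)^(2^(m-1) - 1) * (x - y)^(2^(m-1) - 3)
         + (2^(m-3) - 1) * (w - z)^4 * (x + y)^(2^(m-1)) * (x - y)^(2^(m-1) - 4)
         + (w - z)^4 * (x - y)^(2^m - 4)))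
     \<and> (u1 + u2 = u3 \<longrightarrow>
       jacobi_poly (dual_code C) T =
         const_poly (1 / 2^(m+1)) *
         ((w + z)^4 * (x + y)^(2^m - 4)
         + (2^(m-2) - 1) * (w + z)^4 * (x + y)^(2^(m-1) - 4) * (x - y)^(2^(m-1))
         + 3 * 2^(m-1) * (w + z)^2 * (w - z)^2 * (x + y)^(2^(m-1) - 2) * (x - y)^(2^(m-1) - 2)
         + (2^(m-2) - 1) * (w - z)^4 * (x + y)^(2^(m-1)) * (x - y)^(2^(m-1) - 4)
         + (w - z)^4 * (x - y)^(2^m - 4)))"
proof -
  note card = T(2)[unfolded T(1)]
  show ?thesis
    \<comment> \<open>The dual code is rewritten first, because \<open>jacobi_poly_eq\<close> would
      match its Jacobi polynomial as well.\<close>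
    unfolding C T(1) vars jacobi_poly_dual_RM1 unfolding jacobi_poly_eq m
    by (intro conjI impI)
      (simp_all only: jacobi_at_RM1_independent[OF card _ refl]
        jacobi_at_RM1_dependent[OF card _ refl] not_False_eq_True)
qed

end
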